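(* For every positive integer $n$, the Tamari lattice $T_n$ is isomorphic to a sublattice of the permutation lattice $S_n$, and the embedding can be chosen to preserve the height of elements. That is, there exists an injective map $\phi : T_n \to S_n$ such that $\phi(E\vee F)=\phi(E)\vee\phi(F)$ and $\phi(E\wedge F)=\phi(E)\wedge\phi(F)$ for all $E,F\in T_n$, and such that for every $E\in T_n$ the height of $E$ in $T_n$ equals the height of $\phi(E)$ in $S_n$.
   Context: Let $\mathbf{n}=\{1,2,\dots,n\}$. Permutation lattice $S_n$: for a permutation $\sigma=\langle s_1,\dots,s_n\rangle$ of $\mathbf{n}$ (written as a list), let $I(\sigma)=\{(s_i,s_j) : i<j,\ s_i>s_j\}$ be its set of inversions. $S_n$ is the collection of all sets $I(\sigma)$, for $\sigma$ a permutation of $\mathbf{n}$, ordered by inclusion. It is known that this partially ordered set is a lattice. Tamari lattice $T_n$: a bracketing function on $\mathbf{n}$ is a function $E:\mathbf{n}\to\mathbf{n}$ such that (E1) $k\leq E(k)$ for each $1\leq k\leq n$; (E2) if $k\leq j\leq E(k)$, then $E(j)\leq E(k)$. $T_n$ is the set of all bracketing functions on $\mathbf{n}$, ordered point-wise: $E\leq F$ if and only if $E(k)\leq F(k)$ for each $1\leq k\leq n$. It is known that this partially ordered set is a lattice. The height of an element $a$ of a finite lattice is the length of a longest chain from the least element $0$ to $a$. In each lattice, $\vee$ and $\wedge$ denote join and meet. *)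

theory Defs
  imports "HOL-Algebra.Lattice" "HOL-Library.FuncSet" "HOL-Combinatorics.Multiset_Permutations"
begin

text \<open>Permutations of \<open>{1..n}\<close> are lists; inversions are pairs of values.\<close>

definition inversions :: "nat list \<Rightarrow> (nat \<times> nat) set" where
  "inversions s = {(s ! i, s ! j) | i j. i < j \<and> j < length s \<and> s ! i > s ! j}"

definition permutation_lattice :: "nat \<Rightarrow> (nat \<times> nat) set gorder" where
  "permutation_lattice n =
     \<lparr>carrier = inversions ` permutations_of_set {1..n}, eq = (=), le = (\<subseteq>)\<rparr>"

text \<open>Functions on \<open>{1..n}\<close> are taken extensional (\<open>undefined\<close> outside \<open>{1..n}\<close>), so that
  HOL equality is equality of functions on \<open>{1..n}\<close>.\<close>

definition bracketing :: "nat \<Rightarrow> (nat \<Rightarrow> nat) \<Rightarrow> bool" where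
  "bracketing n E \<longleftrightarrow>
     E \<in> {1..n} \<rightarrow>\<^sub>E {1..n} \<and>
     (\<forall>k\<in>{1..n}. k \<le> E k) \<and>
     (\<forall>k\<in>{1..n}. \<forall>j\<in>{1..n}. k \<le> j \<and> j \<le> E k \<longrightarrow> E j \<le> E k)"

definition tamari_lattice :: "nat \<Rightarrow> (nat \<Rightarrow> nat) gorder" where
  "tamari_lattice n =
     \<lparr>carrier = {E. bracketing n E}, eq = (=), le = (\<lambda>E F. \<forall>k\<in>{1..n}. E k \<le> F k)\<rparr>"

definition chain_from_to :: "('a, 'b) gorder_scheme \<Rightarrow> 'a \<Rightarrow> 'a \<Rightarrow> 'a set \<Rightarrow> bool" where
  "chain_from_to L a b C \<longleftrightarrow>
     C \<subseteq> \<lbrace>a..b\<rbrace>\<^bsub>L\<^esub> \<and> a \<in> C \<and> b \<in> C \<and> (\<forall>x\<in>C. \<forall>y\<in>C. x \<sqsubseteq>\<^bsub>L\<^esub> y \<or> y \<sqsubseteq>\<^bsub>L\<^esub> x)"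

text \<open>The length of a chain is its number of elements minus one. The definition is meant for
  finite \<open>L\<close> and \<open>a \<in> carrier L\<close>, where the maximum is over a finite nonempty set.\<close>

definition height :: "('a, 'b) gorder_scheme \<Rightarrow> 'a \<Rightarrow> nat" where
  "height L a = Max {card C - 1 | C. chain_from_to L \<bottom>\<^bsub>L\<^esub> a C}"


text \<open>The library's \<open>\<squnion>\<close>, \<open>\<sqinter>\<close> and \<open>\<bottom>\<close> are choice terms, meaningful only where the bounds
  exist. The rest of this theory shows that both orders are finite lattices.\<close>

lemma finite_permutation_lattice: "finite (carrier (permutation_lattice n))"
  by (simp add: permutation_lattice_def)

lemma finite_tamari_lattice: "finite (carrier (tamari_lattice n))"
proof (rule finite_subset)
  show "carrier (tamari_lattice n) \<subseteq> {1..n} \<rightarrow>\<^sub>E {1..n}"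
    by (auto simp: tamari_lattice_def bracketing_def)
  show "finite ({1..n} \<rightarrow>\<^sub>E {1..n})"
    by (simp add: finite_PiE)
qed

lemma partial_order_permutation_lattice: "partial_order (permutation_lattice n)"
  by unfold_locales (auto simp: permutation_lattice_def)

lemma partial_order_tamari_lattice: "partial_order (tamari_lattice n)"
proof unfold_locales
  fix E F assume "E \<sqsubseteq>\<^bsub>tamari_lattice n\<^esub> F" "F \<sqsubseteq>\<^bsub>tamari_lattice n\<^esub> E"
    "E \<in> carrier (tamari_lattice n)" "F \<in> carrier (tamari_lattice n)"
  then have "E = F"
    by (intro PiE_ext[of E "{1..n}" "\<lambda>_. {1..n}" F])
       (auto simp: tamari_lattice_def bracketing_def intro: order_antisym)
  then show "E .=\<^bsub>tamari_lattice n\<^esub> F"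
    by (simp add: tamari_lattice_def)
next
  fix E F G assume "E \<sqsubseteq>\<^bsub>tamari_lattice n\<^esub> F" "F \<sqsubseteq>\<^bsub>tamari_lattice n\<^esub> G"
  then show "E \<sqsubseteq>\<^bsub>tamari_lattice n\<^esub> G"
    by (auto simp: tamari_lattice_def intro: order_trans)
qed (auto simp: tamari_lattice_def)

lemma tamari_inf_exists:
  assumes "U \<subseteq> {E. bracketing n E}" "U \<noteq> {}"
  obtains G where "bracketing n G" "\<And>H k. H \<in> U \<Longrightarrow> k \<in> {1..n} \<Longrightarrow> G k \<le> H k"
    "\<And>k. k \<in> {1..n} \<Longrightarrow> \<exists>H\<in>U. G k = H k"
proof
  define G where "G = (\<lambda>k\<in>{1..n}. LEAST m. \<exists>H\<in>U. m = H k)"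
  show le: "G k \<le> H k" if "H \<in> U" "k \<in> {1..n}" for H k
    using that by (auto simp: G_def intro!: Least_le)
  show ex: "\<exists>H\<in>U. G k = H k" if "k \<in> {1..n}" for k
  proof -
    have "\<exists>m. \<exists>H\<in>U. m = H k" using assms(2) by auto
    from LeastI_ex[OF this] show ?thesis using that by (simp add: G_def)
  qed
  have U: "bracketing n H" if "H \<in> U" for H
    using that assms by auto
  show "bracketing n G"
    unfolding bracketing_def
  proof (intro conjI ballI impI)
    show "G \<in> {1..n} \<rightarrow>\<^sub>E {1..n}"
    proof (rule PiE_I)
      fix k assume "k \<in> {1..n}"
      with ex[of k] U show "G k \<in> {1..n}"
        unfolding bracketing_def by (metis PiE_mem)
    qed (auto simp: G_def)
    show "k \<le> G k" if "k \<in> {1..n}" for k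
      using ex[OF that] U that unfolding bracketing_def by metis
    show "G j \<le> G k" if "k \<in> {1..n}" "j \<in> {1..n}" "k \<le> j \<and> j \<le> G k" for k j
    proof -
      obtain H where H: "H \<in> U" "G k = H k" using ex \<open>k \<in> {1..n}\<close> by blast
      have "G j \<le> H j" using le H that by blast
      also have "H j \<le> H k" using U[OF H(1)] that H(2) unfolding bracketing_def by metis
      finally show ?thesis using H by simp
    qed
  qed
qed

lemma lattice_tamari_lattice: "lattice (tamari_lattice n)"
proof -
  interpret partial_order "tamari_lattice n"
    by (rule partial_order_tamari_lattice)
  show ?thesis
  proof unfold_locales
    fix E F assume "E \<in> carrier (tamari_lattice n)" "F \<in> carrier (tamari_lattice n)"
    then have EF: "bracketing n E" "bracketing n F"
      by (auto simp: tamari_lattice_def)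
    have c: "{E, F} \<inter> {E. bracketing n E} = {E, F}" using EF by auto
    show "\<exists>s. least (tamari_lattice n) s (Upper (tamari_lattice n) {E, F})"
    proof -
      define U where "U = Upper (tamari_lattice n) {E, F}"
      have U: "U = {H. bracketing n H \<and> (\<forall>k\<in>{1..n}. E k \<le> H k \<and> F k \<le> H k)}"
        unfolding U_def Upper_def tamari_lattice_def using EF by auto
      have "(\<lambda>k\<in>{1..n}. n) \<in> U"
        using EF unfolding U bracketing_def by (auto simp: PiE_iff)
      then obtain G where "bracketing n G" "\<And>H k. H \<in> U \<Longrightarrow> k \<in> {1..n} \<Longrightarrow> G k \<le> H k"
        "\<And>k. k \<in> {1..n} \<Longrightarrow> \<exists>H\<in>U. G k = H k"
        using tamari_inf_exists[of U n] unfolding U by blast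
      then have "G \<in> U" "\<forall>H\<in>U. G \<sqsubseteq>\<^bsub>tamari_lattice n\<^esub> H" 
        unfolding U tamari_lattice_def by (fastforce, auto)
      then show ?thesis
        unfolding least_def U_def[symmetric] by (auto simp: U_def Upper_def)
    qed
    show "\<exists>s. greatest (tamari_lattice n) s (Lower (tamari_lattice n) {E, F})"
    proof -
      obtain G where G: "bracketing n G" "\<And>H k. H \<in> {E, F} \<Longrightarrow> k \<in> {1..n} \<Longrightarrow> G k \<le> H k"
        "\<And>k. k \<in> {1..n} \<Longrightarrow> \<exists>H\<in>{E, F}. G k = H k"
        using tamari_inf_exists[of "{E, F}" n] EF by (metis c inf.cobounded2 insert_not_empty)
      have "G \<in> Lower (tamari_lattice n) {E, F}"
        using G(1,2) by (auto simp: Lower_def tamari_lattice_def)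
      moreover have "H \<sqsubseteq>\<^bsub>tamari_lattice n\<^esub> G" if "H \<in> Lower (tamari_lattice n) {E, F}" for H
        using that G(3) EF by (fastforce simp: Lower_def tamari_lattice_def)
      ultimately show ?thesis
        unfolding greatest_def by (auto simp: Lower_def)
    qed
  qed
qed

definition inv_closed :: "nat \<Rightarrow> (nat \<times> nat) set \<Rightarrow> bool" where
  "inv_closed n A \<longleftrightarrow> A \<subseteq> {(x, y). 1 \<le> y \<and> y < x \<and> x \<le> n} \<and> trans A \<and>
     (\<forall>x y z. (x, z) \<in> A \<longrightarrow> z < y \<longrightarrow> y < x \<longrightarrow> (x, y) \<in> A \<or> (y, z) \<in> A)"

lemma ex_sorted_wrt_list:
  assumes "finite V" "transp_on V R" "totalp_on V R"
  shows "\<exists>xs. set xs = V \<and> distinct xs \<and> sorted_wrt R xs"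
  using assms
proof (induction V)
  case (insert a V)
  then obtain xs where xs: "set xs = V" "distinct xs" "sorted_wrt R xs"
    by (meson subset_insertI totalp_on_subset transp_on_subset)
  let ?ys = "filter (\<lambda>x. R x a) xs @ a # filter (\<lambda>x. \<not> R x a) xs"
  have "set ?ys = insert a V" "distinct ?ys" using xs insert by auto
  moreover have "sorted_wrt R ?ys"
  proof -
    have tot: "R a x" if "x \<in> V" "\<not> R x a" for x
      using insert.prems(2) insert.hyps that unfolding totalp_on_def by (metis insertCI)
    have tr: "R x z" if "x \<in> V" "z \<in> V" "R x a" "R a z" for x z
      using insert.prems(1) that by (meson insertCI transp_onD)
    have "R x z" if "x \<in> V" "z \<in> V" "R x a" "\<not> R z a" for x z
      using that tot tr by blast
    then show ?thesis
      using xs tot by (simp add: sorted_wrt_append sorted_wrt_filter)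
  qed
  ultimately show ?case by blast
qed simp

lemma inversions_closed:
  assumes "s \<in> permutations_of_set {1..n}"
  shows "inv_closed n (inversions s)"
proof -
  have s: "set s = {1..n}" "distinct s"
    using assms by (auto dest: permutations_of_setD)
  have mem: "(s ! i, s ! j) \<in> inversions s \<longleftrightarrow> i < j \<and> s ! j < s ! i"
    if "i < length s" "j < length s" for i j
    using that s(2) by (auto simp: inversions_def nth_eq_iff_index_eq)
  have idx: "\<exists>i < length s. x = s ! i" if "x \<in> {1..n}" for x
    using that s(1) by (metis in_set_conv_nth)
  have sub: "inversions s \<subseteq> {(x, y). 1 \<le> y \<and> y < x \<and> x \<le> n}"
    using s(1) by (force simp: inversions_def set_conv_nth)
  moreover have "trans (inversions s)"
  proof (rule transI)
    fix x y z assume a: "(x, y) \<in> inversions s" "(y, z) \<in> inversions s"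
    then have "x \<in> {1..n}" "y \<in> {1..n}" "z \<in> {1..n}" using sub by auto
    then obtain i j k where "i < length s" "x = s ! i" "j < length s" "y = s ! j"
      "k < length s" "z = s ! k" using idx by metis
    then show "(x, z) \<in> inversions s" using a by (auto simp: mem)
  qed
  moreover have "(x, y) \<in> inversions s \<or> (y, z) \<in> inversions s"
    if a: "(x, z) \<in> inversions s" "z < y" "y < x" for x y z
  proof -
    have "x \<in> {1..n}" "y \<in> {1..n}" "z \<in> {1..n}" using sub a by auto
    then obtain i j k where "i < length s" "x = s ! i" "j < length s" "y = s ! j"
      "k < length s" "z = s ! k" using idx by metis
    then show ?thesis using a by (auto simp: mem)
  qed
  ultimately show ?thesis unfolding inv_closed_def by blast
qed

lemma closed_inversions:
  assumes "inv_closed n A"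
  shows "A \<in> inversions ` permutations_of_set {1..n}"
proof -
  define R where "R = (\<lambda>x y. (x, y) \<in> A \<or> (x < y \<and> (y, x) \<notin> A))"
  have A: "A \<subseteq> {(x, y). 1 \<le> y \<and> y < x \<and> x \<le> n}" and tr: "trans A" and
    ct: "\<And>x y z. (x, z) \<in> A \<Longrightarrow> z < y \<Longrightarrow> y < x \<Longrightarrow> (x, y) \<in> A \<or> (y, z) \<in> A"
    using assms unfolding inv_closed_def by blast+
  have less: "y < x" "1 \<le> y" "x \<le> n" if "(x, y) \<in> A" for x y using A that by auto
  have "totalp_on {1..n} R"
    by (auto simp: totalp_on_def R_def)
  moreover have "transp_on {1..n} R"
  proof (rule transp_onI)
    fix x y z assume "R x y" "R y z"
    then consider "(x, y) \<in> A" "(y, z) \<in> A" | "(x, y) \<in> A" "y < z" "(z, y) \<notin> A"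
      | "x < y" "(y, x) \<notin> A" "(y, z) \<in> A" | "x < y" "(y, x) \<notin> A" "y < z" "(z, y) \<notin> A"
      unfolding R_def by blast
    then show "R x z"
    proof cases
      case 1 then show ?thesis using tr unfolding R_def by (meson transD)
    next
      case 2
      then show ?thesis
        using ct[of x y z] less[of x y] tr unfolding R_def
        by (metis linorder_neqE_nat transD)
    next
      case 3
      then show ?thesis
        using ct[of y z x] less[of y z] tr unfolding R_def
        by (metis linorder_neqE_nat transD)
    next
      case 4
      then show ?thesis
        using ct[of z x y] unfolding R_def by auto
    qed
  qed
  ultimately obtain s where s: "set s = {1..n}" "distinct s" "sorted_wrt R s"
    using ex_sorted_wrt_list[of "{1..n}" R] by auto
  have R: "R (s ! i) (s ! j)" if "i < j" "j < length s" for i j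
    using s(3) that by (simp add: sorted_wrt_nth_less)
  have asym: "\<not> (R x y \<and> R y x)" for x y
    unfolding R_def using less[of x y] less[of y x] by auto
  have "inversions s = A"
  proof (intro Set.set_eqI iffI)
    fix p assume "p \<in> inversions s"
    then show "p \<in> A"
      using R unfolding inversions_def R_def by fastforce
  next
    fix p assume p: "p \<in> A"
    then obtain x y where xy: "p = (x, y)" "y < x" "x \<in> {1..n}" "y \<in> {1..n}"
      using A by fastforce
    then obtain i j where ij: "i < length s" "j < length s" "x = s ! i" "y = s ! j"
      using s(1) by (metis in_set_conv_nth)
    have "R x y" using p xy unfolding R_def by simp
    then have "i < j"
      using asym R ij xy(2) by (metis less_irrefl linorder_neqE_nat)
    then show "p \<in> inversions s" using xy ij unfolding inversions_def by auto
  qed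
  moreover have "s \<in> permutations_of_set {1..n}" using s by (simp add: permutations_of_setI)
  ultimately show ?thesis by blast
qed

lemma carrier_permutation_lattice: "carrier (permutation_lattice n) = {A. inv_closed n A}"
proof -
  have "carrier (permutation_lattice n) = inversions ` permutations_of_set {1..n}"
    by (simp add: permutation_lattice_def)
  also have "\<dots> = {A. inv_closed n A}"
  proof (intro Set.set_eqI iffI)
    fix A assume "A \<in> inversions ` permutations_of_set {1..n}"
    then obtain s where "s \<in> permutations_of_set {1..n}" "A = inversions s" by (rule imageE)
    then show "A \<in> {A. inv_closed n A}" by (metis inversions_closed mem_Collect_eq)
  next
    fix A assume "A \<in> {A. inv_closed n A}"
    then have "inv_closed n A" by (rule CollectD)
    then show "A \<in> inversions ` permutations_of_set {1..n}" by (rule closed_inversions)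
  qed
  finally show ?thesis .
qed

lemma inv_closed_compl:
  assumes "inv_closed n A"
  shows "inv_closed n ({(x, y). 1 \<le> y \<and> y < x \<and> x \<le> n} - A)"
proof -
  have A: "\<And>x y. (x, y) \<in> A \<Longrightarrow> 1 \<le> y \<and> y < x \<and> x \<le> n" and
    tr: "\<And>x y z. (x, y) \<in> A \<Longrightarrow> (y, z) \<in> A \<Longrightarrow> (x, z) \<in> A" and
    ct: "\<And>x y z. (x, z) \<in> A \<Longrightarrow> z < y \<Longrightarrow> y < x \<Longrightarrow> (x, y) \<in> A \<or> (y, z) \<in> A"
    using assms unfolding inv_closed_def trans_def by blast+
  show ?thesis
    unfolding inv_closed_def
  proof (intro conjI allI impI transI)
    fix x y z assume "(x, y) \<in> {(x, y). 1 \<le> y \<and> y < x \<and> x \<le> n} - A"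
      "(y, z) \<in> {(x, y). 1 \<le> y \<and> y < x \<and> x \<le> n} - A"
    then show "(x, z) \<in> {(x, y). 1 \<le> y \<and> y < x \<and> x \<le> n} - A"
      using ct[of x z y] by auto
  next
    fix x y z assume "(x, z) \<in> {(x, y). 1 \<le> y \<and> y < x \<and> x \<le> n} - A" "z < y" "y < x"
    then show "(x, y) \<in> {(x, y). 1 \<le> y \<and> y < x \<and> x \<le> n} - A \<or>
        (y, z) \<in> {(x, y). 1 \<le> y \<and> y < x \<and> x \<le> n} - A"
      using tr[of x y z] by auto
  qed auto
qed

lemma trancl_subset_trans:
  assumes "trans C" "A \<subseteq> C"
  shows "A\<^sup>+ \<subseteq> C"
  using trancl_mono[of _ A C] assms by (auto simp: trancl_id)

lemma inv_closed_join:
  assumes "inv_closed n A" "inv_closed n B"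
  shows "inv_closed n ((A \<union> B)\<^sup>+)"
proof -
  let ?W = "{(x, y). 1 \<le> y \<and> y < x \<and> x \<le> n}"
  have W: "A \<union> B \<subseteq> ?W" and
    ct: "\<And>x y z. (x, z) \<in> A \<union> B \<Longrightarrow> z < y \<Longrightarrow> y < x \<Longrightarrow> (x, y) \<in> A \<union> B \<or> (y, z) \<in> A \<union> B"
    using assms unfolding inv_closed_def by blast+
  have "trans ?W" by (auto intro!: transI)
  then have "(A \<union> B)\<^sup>+ \<subseteq> ?W" using W by (rule trancl_subset_trans)
  moreover have "(x, y) \<in> (A \<union> B)\<^sup>+ \<or> (y, z) \<in> (A \<union> B)\<^sup>+"
    if "(x, z) \<in> (A \<union> B)\<^sup>+" "z < y" "y < x" for x y z
    using that
  proof (induction rule: trancl_induct)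
    case (base z)
    then show ?case using ct[of x z y] by blast
  next
    case (step w z)
    consider "y = w" | "w < y" | "y < w" by linarith
    then show ?case
    proof cases
      case 1 then show ?thesis using step by simp
    next
      case 2 then show ?thesis using step by (meson trancl_into_trancl)
    next
      case 3 then show ?thesis using step ct[of w z y] by (meson r_into_trancl' trancl_into_trancl)
    qed
  qed
  ultimately show ?thesis unfolding inv_closed_def by auto
qed

lemma inv_closed_join_least:
  assumes "inv_closed n C" "A \<subseteq> C" "B \<subseteq> C"
  shows "(A \<union> B)\<^sup>+ \<subseteq> C"
  using assms unfolding inv_closed_def by (intro trancl_subset_trans) auto

lemma lattice_permutation_lattice: "lattice (permutation_lattice n)"
proof -
  interpret partial_order "permutation_lattice n"
    by (rule partial_order_permutation_lattice)
  have le: "A \<sqsubseteq>\<^bsub>permutation_lattice n\<^esub> B \<longleftrightarrow> A \<subseteq> B" for A B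
    by (simp add: permutation_lattice_def)
  let ?W = "{(x, y). 1 \<le> y \<and> y < x \<and> x \<le> n}"
  show ?thesis
  proof unfold_locales
    fix A B assume "A \<in> carrier (permutation_lattice n)" "B \<in> carrier (permutation_lattice n)"
    then have AB: "inv_closed n A" "inv_closed n B"
      by (auto simp: carrier_permutation_lattice)
    have "least (permutation_lattice n) ((A \<union> B)\<^sup>+) (Upper (permutation_lattice n) {A, B})"
      unfolding least_def Upper_def le carrier_permutation_lattice
      using inv_closed_join[OF AB] inv_closed_join_least[of n _ A B] AB by auto
    then show "\<exists>s. least (permutation_lattice n) s (Upper (permutation_lattice n) {A, B})" ..
    define M where "M = ?W - ((?W - A) \<union> (?W - B))\<^sup>+"
    have "inv_closed n M"
      unfolding M_def by (intro inv_closed_compl inv_closed_join AB)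
    moreover have "M \<subseteq> A" "M \<subseteq> B" unfolding M_def by auto
    moreover have "C \<subseteq> M" if C: "inv_closed n C" "C \<subseteq> A" "C \<subseteq> B" for C
    proof -
      have "((?W - A) \<union> (?W - B))\<^sup>+ \<subseteq> ?W - C"
        using C by (intro inv_closed_join_least[OF inv_closed_compl]) auto
      moreover have "C \<subseteq> ?W" using C(1) unfolding inv_closed_def by blast
      ultimately show ?thesis unfolding M_def by blast
    qed
    ultimately have "greatest (permutation_lattice n) M (Lower (permutation_lattice n) {A, B})"
      unfolding greatest_def Lower_def le carrier_permutation_lattice using AB by auto
    then show "\<exists>s. greatest (permutation_lattice n) s (Lower (permutation_lattice n) {A, B})" ..
  qed
qed

end

theory Submission
  imports Defs
begin

text \<open>
  The embedding sends \<open>E\<close> to the set of pairs \<open>(x, y)\<close> with \<open>y < x \<le> E y\<close>. Its image consists of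
  the transitive sets \<open>A\<close> of decreasing pairs in which \<open>(x, z) \<in> A\<close> and \<open>z < y < x\<close> imply
  \<open>(y, z) \<in> A\<close>. This class is closed under intersection and under the transitive closure of a
  union, which gives meets and joins. In both lattices the height is the number of inversions: a
  chain of finite sets from \<open>{}\<close> to \<open>A\<close> has length at most \<open>card A\<close>, and every nonempty set \<open>A\<close>
  in the image remains in the image after removal of the pair \<open>(E k, k)\<close>, where \<open>k\<close> is the
  largest index with \<open>k < E k\<close>.
\<close>

section \<open>Bracketing functions and left closed sets of pairs\<close>

definition tamari_inversions :: "nat \<Rightarrow> (nat \<Rightarrow> nat) \<Rightarrow> (nat \<times> nat) set" where
  "tamari_inversions n E = {(x, y). y \<in> {1..n} \<and> y < x \<and> x \<le> E y}"

text \<open>In terms of permutations, these are the inversion sets of the 312-avoiding ones: when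
  \<open>x\<close> precedes a smaller \<open>z\<close>, every value strictly between them also
  precedes \<open>z\<close>.\<close>

definition left_closed :: "nat \<Rightarrow> (nat \<times> nat) set \<Rightarrow> bool" where
  "left_closed n A \<longleftrightarrow> A \<subseteq> {(x, y). 1 \<le> y \<and> y < x \<and> x \<le> n} \<and> trans A \<and>
     (\<forall>x y z. (x, z) \<in> A \<longrightarrow> z < y \<longrightarrow> y < x \<longrightarrow> (y, z) \<in> A)"

lemma left_closed_inv_closed: "left_closed n A \<Longrightarrow> inv_closed n A"
  unfolding left_closed_def inv_closed_def by blast

lemma bracketing_range: "bracketing n E \<Longrightarrow> k \<in> {1..n} \<Longrightarrow> k \<le> E k \<and> E k \<le> n"
  unfolding bracketing_def by fastforce

text \<open>Transitivity comes from the second bracketing condition, applied to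
  \<open>z \<le> y \<le> E z\<close>. The last clause holds because the first components paired with
  \<open>z\<close> fill the interval from \<open>z + 1\<close> to \<open>E z\<close>.\<close>

lemma left_closed_tamari_inversions:
  assumes "bracketing n E"
  shows "left_closed n (tamari_inversions n E)"
  unfolding left_closed_def
proof (intro conjI allI impI transI)
  show "tamari_inversions n E \<subseteq> {(x, y). 1 \<le> y \<and> y < x \<and> x \<le> n}"
    using bracketing_range[OF assms] by (fastforce simp: tamari_inversions_def)
next
  fix x y z assume a: "(x, y) \<in> tamari_inversions n E" "(y, z) \<in> tamari_inversions n E"
  then have "E y \<le> E z"
    using assms by (simp add: tamari_inversions_def bracketing_def)
  with a show "(x, z) \<in> tamari_inversions n E"
    by (simp add: tamari_inversions_def)
qed (auto simp: tamari_inversions_def)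

text \<open>The inverse construction: \<open>E k\<close> is the largest \<open>x\<close> with
  \<open>(x, k) \<in> A\<close>, or \<open>k\<close> if there is none.\<close>

lemma left_closedE:
  assumes "left_closed n A"
  obtains E where "bracketing n E" "tamari_inversions n E = A"
proof
  have A: "\<And>x y. (x, y) \<in> A \<Longrightarrow> 1 \<le> y \<and> y < x \<and> x \<le> n" and
    tr: "\<And>x y z. (x, y) \<in> A \<Longrightarrow> (y, z) \<in> A \<Longrightarrow> (x, z) \<in> A" and
    cl: "\<And>x y z. (x, z) \<in> A \<Longrightarrow> z < y \<Longrightarrow> y < x \<Longrightarrow> (y, z) \<in> A"
    using assms unfolding left_closed_def trans_def by blast+
  \<comment> \<open>Inserting \<open>k\<close> keeps the set nonempty, so that \<open>Max\<close> is
    meaningful, and forces \<open>k \<le> E k\<close>.\<close>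
  define S where "S k = insert k {x. (x, k) \<in> A}" for k
  define E where "E = (\<lambda>k\<in>{1..n}. Max (S k))"
  have fin: "finite (S k)" for k
    by (rule finite_subset[of _ "insert k {..n}"]) (use A in \<open>auto simp: S_def\<close>)
  have mem: "E k \<in> S k" if "k \<in> {1..n}" for k
    using Max_in[OF fin, of k] that by (auto simp: E_def S_def)
  have ge: "x \<le> E k" if "k \<in> {1..n}" "x \<in> S k" for k x
    using that fin by (simp add: E_def)
  have iff: "(x, k) \<in> A \<longleftrightarrow> k < x \<and> x \<le> E k" if "k \<in> {1..n}" for x k
  proof
    assume "(x, k) \<in> A"
    then show "k < x \<and> x \<le> E k" using A ge[OF that] by (simp add: S_def)
  next
    assume x: "k < x \<and> x \<le> E k"
    then have "(E k, k) \<in> A" using mem[OF that] by (simp add: S_def)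
    then show "(x, k) \<in> A" using x cl[of "E k" k x] by (cases "x = E k") auto
  qed
  have k_le: "k \<le> E k" if "k \<in> {1..n}" for k
    using ge[OF that] by (simp add: S_def)
  have le_n: "E k \<le> n" if "k \<in> {1..n}" for k
    using mem[OF that] A that by (auto simp: S_def)
  show "bracketing n E"
    unfolding bracketing_def
  proof (intro conjI ballI impI)
    show "E \<in> {1..n} \<rightarrow>\<^sub>E {1..n}"
    proof (rule PiE_I)
      fix k assume "k \<in> {1..n}"
      then show "E k \<in> {1..n}" using k_le[of k] le_n[of k] by simp
    qed (simp only: E_def restrict_apply if_False)
  next
    fix k assume "k \<in> {1..n}"
    then show "k \<le> E k" by (rule k_le)
  next
    fix k j assume kj: "k \<in> {1..n}" "j \<in> {1..n}" "k \<le> j \<and> j \<le> E k"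
    show "E j \<le> E k"
    proof (rule ccontr)
      assume "\<not> E j \<le> E k"
      \<comment> \<open>Transitivity through \<open>j\<close> would put \<open>(E j, k)\<close> into
        \<open>A\<close>, against the maximality of \<open>E k\<close>.\<close>
      then have "k < j" "j < E j" using kj by (auto intro: le_neq_implies_less)
      then have "(E j, j) \<in> A" "(j, k) \<in> A" using kj iff by auto
      then show False using tr iff kj(1) \<open>\<not> E j \<le> E k\<close> by blast
    qed
  qed
  have "(x, y) \<in> tamari_inversions n E \<longleftrightarrow> (x, y) \<in> A" for x y
    using iff[of y x] A[of x y] by (auto simp: tamari_inversions_def)
  then show "tamari_inversions n E = A"
    by (intro Set.set_eqI) (simp only: split_paired_all)
qed

section \<open>Left closed sets under intersection and transitive closure of unions\<close>

lemma left_closed_Int: "left_closed n A \<Longrightarrow> left_closed n B \<Longrightarrow> left_closed n (A \<inter> B)"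
  unfolding left_closed_def by (auto intro: trans_Int)

text \<open>Compare \<open>y\<close> with the start \<open>w\<close> of the last edge
  \<open>(w, z)\<close> of a path from \<open>x\<close> to \<open>z\<close>. Above \<open>w\<close>,
  the induction hypothesis gives a path from \<open>y\<close> to \<open>w\<close>, which the edge
  extends; below \<open>w\<close>, left closure of the single edge suffices.\<close>

lemma left_closed_trancl_Un:
  assumes "left_closed n A" "left_closed n B"
  shows "left_closed n ((A \<union> B)\<^sup>+)"
proof -
  have cl: "\<And>x y z. (x, z) \<in> A \<union> B \<Longrightarrow> z < y \<Longrightarrow> y < x \<Longrightarrow> (y, z) \<in> A \<union> B"
    using assms unfolding left_closed_def by blast
  have "(y, z) \<in> (A \<union> B)\<^sup>+" if "(x, z) \<in> (A \<union> B)\<^sup>+" "z < y" "y < x" for x y z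
    using that
  proof (induction rule: trancl_induct)
    case (base z)
    then show ?case using cl by blast
  next
    case (step w z)
    consider "y = w" | "w < y" | "y < w" by linarith
    then show ?case
    proof cases
      case 1 then show ?thesis using step by blast
    next
      case 2 then show ?thesis using step by (meson trancl_into_trancl)
    next
      case 3 then show ?thesis using step cl by blast
    qed
  qed
  moreover have "inv_closed n ((A \<union> B)\<^sup>+)"
    by (intro inv_closed_join left_closed_inv_closed assms)
  ultimately show ?thesis
    unfolding left_closed_def inv_closed_def by blast
qed

section \<open>The order embedding\<close>

text \<open>A value \<open>F k\<close> below \<open>k\<close> yields no pairs, just as
  \<open>F k = k\<close> does; hence the maximum. For bracketing \<open>F\<close> it equals
  \<open>F k\<close>, and inclusion becomes the point-wise order.\<close>

lemma tamari_inversions_subset_iff: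
  assumes "bracketing n E"
  shows "tamari_inversions n E \<subseteq> tamari_inversions n F \<longleftrightarrow> (\<forall>k\<in>{1..n}. E k \<le> max k (F k))"
proof
  assume sub: "tamari_inversions n E \<subseteq> tamari_inversions n F"
  show "\<forall>k\<in>{1..n}. E k \<le> max k (F k)"
  proof
    fix k assume k: "k \<in> {1..n}"
    show "E k \<le> max k (F k)"
    proof (cases "k < E k")
      case True
      then have "(E k, k) \<in> tamari_inversions n E" using k by (simp add: tamari_inversions_def)
      with sub show ?thesis by (auto simp: tamari_inversions_def)
    qed simp
  qed
next
  assume le: "\<forall>k\<in>{1..n}. E k \<le> max k (F k)"
  have "x \<le> F y" if "y \<in> {1..n}" "y < x" "x \<le> E y" for x y
    using bspec[OF le that(1)] that(2,3) by simp
  then show "tamari_inversions n E \<subseteq> tamari_inversions n F"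
    unfolding tamari_inversions_def by blast
qed

lemma carrier_tamari_lattice: "carrier (tamari_lattice n) = {E. bracketing n E}"
  by (simp add: tamari_lattice_def)

lemma le_permutation_lattice [simp]: "A \<sqsubseteq>\<^bsub>permutation_lattice n\<^esub> B \<longleftrightarrow> A \<subseteq> B"
  by (simp add: permutation_lattice_def)

lemma le_tamari_lattice_iff:
  assumes "bracketing n E" "bracketing n F"
  shows "E \<sqsubseteq>\<^bsub>tamari_lattice n\<^esub> F \<longleftrightarrow> tamari_inversions n E \<subseteq> tamari_inversions n F"
  unfolding tamari_inversions_subset_iff[OF assms(1)]
  using bracketing_range[OF assms(2)] by (simp add: tamari_lattice_def max_def)

lemma inj_on_tamari_inversions: "inj_on (tamari_inversions n) {E. bracketing n E}"
proof (rule inj_onI)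
  interpret partial_order "tamari_lattice n" by (rule partial_order_tamari_lattice)
  fix E F
  assume "E \<in> {E. bracketing n E}" "F \<in> {E. bracketing n E}"
    "tamari_inversions n E = tamari_inversions n F"
  then have "E .=\<^bsub>tamari_lattice n\<^esub> F"
    by (intro weak_le_antisym) (auto simp: le_tamari_lattice_iff carrier_tamari_lattice)
  then show "E = F" by (simp add: tamari_lattice_def)
qed

lemma inv_closed_tamari_inversions: "bracketing n E \<Longrightarrow> inv_closed n (tamari_inversions n E)"
  by (intro left_closed_inv_closed left_closed_tamari_inversions)

section \<open>Preservation of joins and meets\<close>

context
  fixes n :: nat
begin

interpretation T: lattice "tamari_lattice n" by (rule lattice_tamari_lattice)
interpretation S: lattice "permutation_lattice n" by (rule lattice_permutation_lattice)

text \<open>A cycle of inclusions through the transitive closure of the union. That closure is left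
  closed, hence the image of some \<open>H\<close>, so the join can be compared with
  \<open>H\<close> inside the Tamari lattice.\<close>

lemma tamari_inversions_join:
  assumes "bracketing n E" "bracketing n F"
  shows "tamari_inversions n (E \<squnion>\<^bsub>tamari_lattice n\<^esub> F) =
    tamari_inversions n E \<squnion>\<^bsub>permutation_lattice n\<^esub> tamari_inversions n F"
proof -
  let ?G = "E \<squnion>\<^bsub>tamari_lattice n\<^esub> F"
  have c: "E \<in> carrier (tamari_lattice n)" "F \<in> carrier (tamari_lattice n)"
    using assms by (auto simp: carrier_tamari_lattice)
  have G: "bracketing n ?G"
    using T.join_closed[OF c] by (simp add: carrier_tamari_lattice)
  have cS: "tamari_inversions n E \<in> carrier (permutation_lattice n)"
    "tamari_inversions n F \<in> carrier (permutation_lattice n)"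
    "tamari_inversions n ?G \<in> carrier (permutation_lattice n)"
    using assms G by (auto simp: carrier_permutation_lattice inv_closed_tamari_inversions)
  have up: "tamari_inversions n E \<subseteq> tamari_inversions n ?G"
    "tamari_inversions n F \<subseteq> tamari_inversions n ?G"
    using T.join_left[OF c] T.join_right[OF c] assms G by (simp_all add: le_tamari_lattice_iff)
  obtain H where H: "bracketing n H"
    "tamari_inversions n H = (tamari_inversions n E \<union> tamari_inversions n F)\<^sup>+"
    using left_closedE[OF left_closed_trancl_Un[OF assms[THEN left_closed_tamari_inversions]]]
    by blast
  have "?G \<sqsubseteq>\<^bsub>tamari_lattice n\<^esub> H"
    by (rule T.join_le) (use c H assms in \<open>auto simp: le_tamari_lattice_iff carrier_tamari_lattice\<close>)
  then have GH: "tamari_inversions n ?G \<subseteq> tamari_inversions n H"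
    using G H by (simp add: le_tamari_lattice_iff)
  let ?J = "tamari_inversions n E \<squnion>\<^bsub>permutation_lattice n\<^esub> tamari_inversions n F"
  have "inv_closed n ?J"
    using S.join_closed[OF cS(1,2)] by (simp add: carrier_permutation_lattice)
  then have "tamari_inversions n H \<subseteq> ?J"
    unfolding H(2) using S.join_left[OF cS(1,2)] S.join_right[OF cS(1,2)]
    by (intro inv_closed_join_least) auto
  moreover have "?J \<subseteq> tamari_inversions n ?G"
    using S.join_le[OF _ _ cS] up by simp
  ultimately show ?thesis using GH by blast
qed

text \<open>A meet in the permutation lattice can be smaller than the intersection. For left closed
  sets the intersection is again left closed, hence the image of some \<open>H\<close>, and the
  three sets coincide.\<close>

lemma tamari_inversions_meet:
  assumes "bracketing n E" "bracketing n F"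
  shows "tamari_inversions n (E \<sqinter>\<^bsub>tamari_lattice n\<^esub> F) =
    tamari_inversions n E \<sqinter>\<^bsub>permutation_lattice n\<^esub> tamari_inversions n F"
proof -
  let ?G = "E \<sqinter>\<^bsub>tamari_lattice n\<^esub> F"
  have c: "E \<in> carrier (tamari_lattice n)" "F \<in> carrier (tamari_lattice n)"
    using assms by (auto simp: carrier_tamari_lattice)
  have G: "bracketing n ?G"
    using T.meet_closed[OF c] by (simp add: carrier_tamari_lattice)
  have cS: "tamari_inversions n E \<in> carrier (permutation_lattice n)"
    "tamari_inversions n F \<in> carrier (permutation_lattice n)"
    "tamari_inversions n ?G \<in> carrier (permutation_lattice n)"
    using assms G by (auto simp: carrier_permutation_lattice inv_closed_tamari_inversions)
  have low: "tamari_inversions n ?G \<subseteq> tamari_inversions n E"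
    "tamari_inversions n ?G \<subseteq> tamari_inversions n F"
    using T.meet_left[OF c] T.meet_right[OF c] assms G by (simp_all add: le_tamari_lattice_iff)
  obtain H where H: "bracketing n H"
    "tamari_inversions n H = tamari_inversions n E \<inter> tamari_inversions n F"
    using left_closedE[OF left_closed_Int[OF assms[THEN left_closed_tamari_inversions]]]
    by blast
  have "H \<sqsubseteq>\<^bsub>tamari_lattice n\<^esub> ?G"
    by (rule T.meet_le) (use c H assms in \<open>auto simp: le_tamari_lattice_iff carrier_tamari_lattice\<close>)
  then have "tamari_inversions n H \<subseteq> tamari_inversions n ?G"
    using G H by (simp add: le_tamari_lattice_iff)
  moreover have "tamari_inversions n E \<sqinter>\<^bsub>permutation_lattice n\<^esub> tamari_inversions n F
      \<subseteq> tamari_inversions n H"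
    unfolding H(2) using S.meet_left[OF cS(1,2)] S.meet_right[OF cS(1,2)] by simp
  moreover have "tamari_inversions n ?G
      \<subseteq> tamari_inversions n E \<sqinter>\<^bsub>permutation_lattice n\<^esub> tamari_inversions n F"
    using S.meet_le[OF _ _ cS] low by simp
  ultimately show ?thesis by blast
qed

section \<open>Least elements\<close>

lemma bottom_permutation_lattice: "\<bottom>\<^bsub>permutation_lattice n\<^esub> = {}"
proof -
  have "least (permutation_lattice n) {} (carrier (permutation_lattice n))"
    by (auto simp: least_def carrier_permutation_lattice inv_closed_def)
  then have "least (permutation_lattice n) \<bottom>\<^bsub>permutation_lattice n\<^esub> (carrier (permutation_lattice n))"
    unfolding bottom_def
    by (rule someI[of "\<lambda>x. least (permutation_lattice n) x (carrier (permutation_lattice n))"])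
  then show ?thesis
    by (auto simp: least_def carrier_permutation_lattice inv_closed_def)
qed

text \<open>The preimage \<open>B\<close> of \<open>{}\<close> is a least element, so the choice
  term denotes one too; lying below \<open>B\<close>, it has empty image.\<close>

lemma bottom_tamari_lattice:
  "bracketing n \<bottom>\<^bsub>tamari_lattice n\<^esub>" "tamari_inversions n \<bottom>\<^bsub>tamari_lattice n\<^esub> = {}"
proof -
  have "left_closed n {}" by (simp add: left_closed_def)
  then obtain B where B: "bracketing n B" "tamari_inversions n B = {}"
    by (rule left_closedE)
  then have "least (tamari_lattice n) B (carrier (tamari_lattice n))"
    by (auto simp: least_def carrier_tamari_lattice le_tamari_lattice_iff)
  then have l: "least (tamari_lattice n) \<bottom>\<^bsub>tamari_lattice n\<^esub> (carrier (tamari_lattice n))"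
    unfolding bottom_def
    by (rule someI[of "\<lambda>x. least (tamari_lattice n) x (carrier (tamari_lattice n))"])
  then show br: "bracketing n \<bottom>\<^bsub>tamari_lattice n\<^esub>"
    by (simp add: least_def carrier_tamari_lattice)
  have "\<bottom>\<^bsub>tamari_lattice n\<^esub> \<sqsubseteq>\<^bsub>tamari_lattice n\<^esub> B"
    using l B by (simp add: least_def carrier_tamari_lattice)
  then show "tamari_inversions n \<bottom>\<^bsub>tamari_lattice n\<^esub> = {}"
    using br B by (simp add: le_tamari_lattice_iff)
qed

section \<open>Chains and heights\<close>

lemma chain_from_to_permutation_lattice_iff:
  "chain_from_to (permutation_lattice n) {} A C \<longleftrightarrow>
    (\<forall>B\<in>C. inv_closed n B \<and> B \<subseteq> A) \<and> {} \<in> C \<and> A \<in> C \<and> (\<forall>X\<in>C. \<forall>Y\<in>C. X \<subseteq> Y \<or> Y \<subseteq> X)"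
  unfolding chain_from_to_def at_least_at_most_def carrier_permutation_lattice by auto

text \<open>Reduces chains of bracketing functions to chains of sets. The condition on
  \<open>C\<close> is stated separately because the map is known to be injective only on bracketing
  functions, so the image of \<open>C\<close> alone does not determine it.\<close>

lemma chain_from_to_tamari_lattice_iff:
  assumes "bracketing n E"
  shows "chain_from_to (tamari_lattice n) \<bottom>\<^bsub>tamari_lattice n\<^esub> E C \<longleftrightarrow>
    C \<subseteq> {F. bracketing n F} \<and>
    chain_from_to (permutation_lattice n) {} (tamari_inversions n E) (tamari_inversions n ` C)"
    (is "?l \<longleftrightarrow> ?r")
proof (cases "C \<subseteq> {F. bracketing n F}")
  case False
  then show ?thesis
    by (auto simp: chain_from_to_def at_least_at_most_def carrier_tamari_lattice)
next
  case True
  let ?B = "\<bottom>\<^bsub>tamari_lattice n\<^esub>" and ?t = "tamari_inversions n"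
  have br: "bracketing n F" if "F \<in> C" for F
    using that True by blast
  have le: "F \<sqsubseteq>\<^bsub>tamari_lattice n\<^esub> G \<longleftrightarrow> ?t F \<subseteq> ?t G" if "F \<in> C" "G \<in> C" for F G
    by (intro le_tamari_lattice_iff br that)
  have interval: "F \<in> \<lbrace>?B..E\<rbrace>\<^bsub>tamari_lattice n\<^esub> \<longleftrightarrow> ?t F \<subseteq> ?t E" if "F \<in> C" for F
    using br[OF that] assms bottom_tamari_lattice
    by (simp add: at_least_at_most_def carrier_tamari_lattice le_tamari_lattice_iff)
  \<comment> \<open>Injectivity pulls the end points of the image chain back to
    \<open>C\<close>.\<close>
  have mem: "?t F \<in> ?t ` C \<longleftrightarrow> F \<in> C" if "bracketing n F" for F
    using inj_on_image_mem_iff[OF inj_on_tamari_inversions] that True by blast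
  have "?l \<longleftrightarrow> (\<forall>F\<in>C. ?t F \<subseteq> ?t E) \<and> ?B \<in> C \<and> E \<in> C \<and>
      (\<forall>F\<in>C. \<forall>G\<in>C. ?t F \<subseteq> ?t G \<or> ?t G \<subseteq> ?t F)"
    by (simp add: chain_from_to_def subset_eq[of C] interval le cong: ball_cong)
  also have "\<dots> \<longleftrightarrow> ?r"
    using True mem[OF assms] mem[OF bottom_tamari_lattice(1)]
    by (simp add: chain_from_to_permutation_lattice_iff bottom_tamari_lattice(2)
        inv_closed_tamari_inversions br cong: ball_cong)
  finally show ?thesis .
qed

text \<open>Nested finite sets of equal size coincide, so \<open>card\<close> is injective on the
  chain, with values among the \<open>card A + 1\<close> numbers up to
  \<open>card A\<close>.\<close>

lemma card_chain_le:
  assumes "chain_from_to (permutation_lattice n) {} A C"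
  shows "card C - 1 \<le> card A"
proof -
  have C: "\<And>X. X \<in> C \<Longrightarrow> X \<subseteq> A" and A: "inv_closed n A"
    and tot: "\<And>X Y. X \<in> C \<Longrightarrow> Y \<in> C \<Longrightarrow> X \<subseteq> Y \<or> Y \<subseteq> X"
    using assms unfolding chain_from_to_permutation_lattice_iff by blast+
  have "A \<subseteq> {..n} \<times> {..n}" using A by (auto simp: inv_closed_def)
  then have finA: "finite A" by (rule finite_subset) simp
  have "inj_on card C"
    using tot C finA by (intro inj_onI) (metis card_subset_eq finite_subset)
  then have "card C = card (card ` C)" by (simp add: card_image)
  also have "\<dots> \<le> card {..card A}"
    using C finA by (intro card_mono) (auto intro: card_mono)
  finally show ?thesis by simp
qed

lemma left_closed_remove:
  assumes "left_closed n A" "A \<noteq> {}"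
  obtains p where "p \<in> A" "left_closed n (A - {p})"
proof -
  obtain E where E: "bracketing n E" "tamari_inversions n E = A"
    using assms(1) by (rule left_closedE)
  define K where "K = {k \<in> {1..n}. k < E k}"
  have "K \<noteq> {}" "finite K"
    using assms(2) by (auto simp: K_def E(2)[symmetric] tamari_inversions_def)
  then have K: "Max K \<in> K" "\<And>j. j \<in> K \<Longrightarrow> j \<le> Max K" by auto
  define k where "k = Max K"
  have k: "(x, k) \<in> A \<longleftrightarrow> k < x \<and> x \<le> E k" "(E k, k) \<in> A" for x
    using K(1) unfolding k_def E(2)[symmetric] tamari_inversions_def K_def by auto
  have last: "y \<le> k" if "(x, y) \<in> A" for x y
  proof -
    have "y \<in> K" using that unfolding E(2)[symmetric] tamari_inversions_def K_def by auto
    then show ?thesis using K(2) by (simp add: k_def)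
  qed
  have A: "A \<subseteq> {(x, y). 1 \<le> y \<and> y < x \<and> x \<le> n}" "trans A"
    and cl: "\<And>x y z. (x, z) \<in> A \<Longrightarrow> z < y \<Longrightarrow> y < x \<Longrightarrow> (y, z) \<in> A"
    using assms(1) unfolding left_closed_def by blast+
  have "left_closed n (A - {(E k, k)})"
    unfolding left_closed_def
  proof (intro conjI allI impI transI)
    fix x y z assume a: "(x, y) \<in> A - {(E k, k)}" "(y, z) \<in> A - {(E k, k)}"
    \<comment> \<open>Since \<open>z < y \<le> k\<close>, the composite pair has second component
      below \<open>k\<close> and is not the removed one.\<close>
    then have "y \<le> k" "z < y" using last A(1) by auto
    then show "(x, z) \<in> A - {(E k, k)}" using a A(2) by (auto dest: transD)
  next
    fix x y z assume a: "(x, z) \<in> A - {(E k, k)}" "z < y" "y < x"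
    \<comment> \<open>If \<open>(y, z)\<close> were the removed pair, then
      \<open>(x, k) \<in> A\<close> with \<open>x > E k\<close>, which is impossible.\<close>
    then show "(y, z) \<in> A - {(E k, k)}" using cl k by auto
  qed (use A in auto)
  with k(2) show thesis by (rule that)
qed

text \<open>Removing one pair at a time reaches \<open>{}\<close> after \<open>card A\<close> steps.
  Staying within left closed sets lets the same chain attain the height in both lattices.\<close>

lemma left_closed_chain:
  assumes "left_closed n A"
  shows "\<exists>D. D \<subseteq> {B. left_closed n B} \<and> chain_from_to (permutation_lattice n) {} A D \<and>
    card D = Suc (card A)"
  using assms
proof (induction "card A" arbitrary: A rule: less_induct)
  case less
  have "A \<subseteq> {..n} \<times> {..n}" using less.prems by (fastforce simp: left_closed_def)
  then have finA: "finite A" by (rule finite_subset) simp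
  show ?case
  proof (cases "A = {}")
    case True
    then show ?thesis using less.prems
      by (intro exI[of _ "{{}}"])
         (auto simp: chain_from_to_permutation_lattice_iff left_closed_inv_closed)
  next
    case False
    then obtain p where p: "p \<in> A" "left_closed n (A - {p})"
      using left_closed_remove less.prems by blast
    then obtain D where D: "D \<subseteq> {B. left_closed n B}"
      "chain_from_to (permutation_lattice n) {} (A - {p}) D" "card D = Suc (card (A - {p}))"
      using less.hyps[of "A - {p}"] finA by (meson card_Diff1_less)
    have DA: "\<And>B. B \<in> D \<Longrightarrow> B \<subseteq> A - {p}"
      using D(2) by (simp add: chain_from_to_permutation_lattice_iff)
    then have "A \<notin> D" using p(1) by blast
    \<comment> \<open>Infinite sets have \<open>card\<close> zero, whereas \<open>card D\<close> is
      a successor.\<close>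
    moreover have "finite D" using D(3) by (metis card.infinite nat.distinct(1))
    ultimately have "card (insert A D) = Suc (card A)"
      using D(3) card_Suc_Diff1[OF finA p(1)] by simp
    moreover have "chain_from_to (permutation_lattice n) {} A (insert A D)"
    proof -
      have "B \<subseteq> A" if "B \<in> D" for B using DA[OF that] by blast
      then show ?thesis
        using D(2) left_closed_inv_closed[OF less.prems]
        by (simp add: chain_from_to_permutation_lattice_iff)
    qed
    ultimately show ?thesis using D(1) less.prems by blast
  qed
qed

lemma height_permutation_lattice:
  assumes "left_closed n A"
  shows "height (permutation_lattice n) A = card A"
  unfolding height_def bottom_permutation_lattice
proof (rule Max_eqI)
  show "finite {card C - 1 |C. chain_from_to (permutation_lattice n) {} A C}"
    by (rule finite_subset[of _ "{..card A}"]) (auto dest: card_chain_le)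
  show "card A \<in> {card C - 1 |C. chain_from_to (permutation_lattice n) {} A C}"
    using left_closed_chain[OF assms] by (metis (mono_tags, lifting) diff_Suc_1 mem_Collect_eq)
qed (auto dest: card_chain_le)

text \<open>The image of a chain has the same size by injectivity, so the bound for chains of sets
  applies. It is attained because a chain of left closed sets is the image of a chain of bracketing
  functions.\<close>

lemma height_tamari_lattice:
  assumes "bracketing n E"
  shows "height (tamari_lattice n) E = card (tamari_inversions n E)"
proof -
  let ?M = "{card C - 1 |C. chain_from_to (tamari_lattice n) \<bottom>\<^bsub>tamari_lattice n\<^esub> E C}"
  have le: "m \<le> card (tamari_inversions n E)" if m: "m \<in> ?M" for m
  proof -
    obtain C where C: "m = card C - 1" "C \<subseteq> {F. bracketing n F}"
      "chain_from_to (permutation_lattice n) {} (tamari_inversions n E) (tamari_inversions n ` C)"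
      using m unfolding chain_from_to_tamari_lattice_iff[OF assms] by blast
    then show ?thesis
      using card_chain_le[OF C(3)] card_image[OF inj_on_subset[OF inj_on_tamari_inversions C(2)]]
      by simp
  qed
  obtain D where D: "D \<subseteq> {B. left_closed n B}"
    "chain_from_to (permutation_lattice n) {} (tamari_inversions n E) D"
    "card D = Suc (card (tamari_inversions n E))"
    using left_closed_chain left_closed_tamari_inversions assms by blast
  have "D \<subseteq> tamari_inversions n ` {F. bracketing n F}"
    using D(1) by (blast elim: left_closedE)
  then obtain C where C: "C \<subseteq> {F. bracketing n F}" "D = tamari_inversions n ` C"
    by (auto simp: subset_image_iff)
  have "card D = card C"
    unfolding C(2) by (rule card_image[OF inj_on_subset[OF inj_on_tamari_inversions C(1)]])
  then have "card (tamari_inversions n E) \<in> ?M"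
    using assms C D by (auto simp: chain_from_to_tamari_lattice_iff intro!: exI[of _ C])
  moreover have "finite ?M"
    by (rule finite_subset[of _ "{..card (tamari_inversions n E)}"]) (use le in auto)
  ultimately show ?thesis unfolding height_def by (intro Max_eqI le)
qed

end

theorem theorem1:
  fixes n :: nat
  assumes "n > 0"
  shows "\<exists>\<phi> :: (nat \<Rightarrow> nat) \<Rightarrow> (nat \<times> nat) set.
    \<phi> \<in> carrier (tamari_lattice n) \<rightarrow> carrier (permutation_lattice n) \<and>
    inj_on \<phi> (carrier (tamari_lattice n)) \<and>
    (\<forall>E\<in>carrier (tamari_lattice n). \<forall>F\<in>carrier (tamari_lattice n).
       \<phi> (E \<squnion>\<^bsub>tamari_lattice n\<^esub> F) = \<phi> E \<squnion>\<^bsub>permutation_lattice n\<^esub> \<phi> F \<and>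
       \<phi> (E \<sqinter>\<^bsub>tamari_lattice n\<^esub> F) = \<phi> E \<sqinter>\<^bsub>permutation_lattice n\<^esub> \<phi> F) \<and>
    (\<forall>E\<in>carrier (tamari_lattice n).
       height (tamari_lattice n) E = height (permutation_lattice n) (\<phi> E))"
  unfolding carrier_tamari_lattice carrier_permutation_lattice
  by (intro exI[of _ "tamari_inversions n"])
     (simp add: inj_on_tamari_inversions inv_closed_tamari_inversions tamari_inversions_join
       tamari_inversions_meet height_tamari_lattice height_permutation_lattice
       left_closed_tamari_inversions)

end
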